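(* Assume that the problem (MaxCG) defined in the context is feasible, with optimal solution $X^*$. For any small $\epsilon>0$, there exist $\mu$ sufficiently large and $\alpha$ sufficiently small such that the penalized problem $$\max_{\{\mathbf y_v\in\Omega_v\}_{v\in\mathcal V}}\ \tilde L(Y)-\frac{\mu}{2|\mathcal V|}\Big[\sum_{v\in\mathcal V}(\mathbf y_v^{\mathsf T}\mathbf 1-c^0_v)\Big]_+^2\qquad(\mathrm P_{\mu,\alpha})$$ approximates (MaxCG) within ratio $1-1/e-\epsilon$ in terms of the caching gain. That is, there exist $\mu_0>0$ and $\alpha_0\in(0,1)$ such that for all $\mu\ge\mu_0$ and all $\alpha\in(0,\alpha_0]$, every optimal solution $Y$ of $(\mathrm P_{\mu,\alpha})$ satisfies $$F(Y)\ \ge\ \Big(1-\frac1e-\epsilon\Big)F(X^* ).$$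
   Context: Notation: $[x]_+=\max\{x,0\}$; $\mathbf 1$ is the all-ones column vector. Network model. $\mathcal G=(\mathcal V,\mathcal E)$ is a finite connected network. $\mathcal C$ is a finite catalog of items; for each $i\in\mathcal C$, $\mathcal S_i\subset\mathcal V$ is the set of designated servers of $i$. $\mathcal R$ is a finite set of requests $(i,p)$, where $i\in\mathcal C$ and $p=(p_1,\dots,p_{|p|})$ is a path in $\mathcal G$ (consecutive nodes are linked) without loops whose last node $p_{|p|}$ is in $\mathcal S_i$. Each request has arrival rate $\lambda_{(i,p)}>0$; each link has cost $w_{uv}\ge 0$. $\bar c_v\in\mathbb N$ is the maximum cache capacity at node $v$, $M>0$ is the network-wide budget, with $M<\sum_{v}\bar c_v$, and $c_v^0\in\mathbb R$ are constants with $\sum_{v\in\mathcal V}c_v^0=M$. Caching gain. For $X=(x_{vi})_{v\in\mathcal V,i\in\mathcal C}\in[0,1]^{|\mathcal V|\times|\mathcal C|}$, $$F(X)=\sum_{(i,p)\in\mathcal R}\lambda_{(i,p)}\sum_{k=1}^{|p|-1}w_{p_{k+1}p_k}\Big(1-\prod_{l=1}^k(1-x_{p_l i})\Big).$$ (MaxCG) is the problem of maximizing $F(X)$ over matrices $X$ such that $x_{vi}\in\{0,1\}$ for all $v\in\mathcal V,i\in\mathcal C$; $x_{vi}=1$ for all $i\in\mathcal C$, $v\in\mathcal S_i$; $\sum_{i\in\mathcal C}x_{vi}\le\bar c_v$ for all $v\in\mathcal V$; and $\sum_{v\in\mathcal V}\sum_{i\in\mathcal C}x_{vi}\le M$. For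 a matrix $Y=(y_{vi})_{v\in\mathcal V,i\in\mathcal C}$, $\mathbf y_v^{\mathsf T}$ is its $v$-th row. Let $$\Omega_v=\Big\{\mathbf y\in[0,1]^{|\mathcal C|}: \sum_{i\in\mathcal C}y_i\le\bar c_v,\ y_i=1\text{ if }v\in\mathcal S_i\Big\}.$$ For $\alpha\in(0,1)$ let $$\tilde L(Y)=\sum_{(i,p)\in\mathcal R}\lambda_{(i,p)}\sum_{k=1}^{|p|-1}w_{p_{k+1}p_k}\,\mathrm{sat}_\alpha\Big(\sum_{l=1}^k y_{p_l i}\Big),$$ where $\mathrm{sat}_\alpha(x)=1$ if $x\ge1+\frac\alpha2$; $\mathrm{sat}_\alpha(x)=1-\frac{(1+\frac\alpha2-x)^2}{2\alpha}$ if $1-\frac\alpha2\le x<1+\frac\alpha2$; $\mathrm{sat}_\alpha(x)=x$ if $0\le x<1-\frac\alpha2$. (So $\tilde L$ depends on $\alpha$.) *)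

theory Defs
  imports Complex_Main "Graph_Theory.Graph_Theory"
begin

text \<open>
  Matrices indexed by nodes and items are functions \<open>'v \<Rightarrow> 'i \<Rightarrow> real\<close>; only the entries at
  \<open>(v, i)\<close> with \<open>v\<close> a node and \<open>i\<close> in the catalog \<open>C\<close> matter, all others are unconstrained and
  occur in no objective function.
\<close>

text \<open>
  The network is an undirected simple graph, i.e. a symmetric loop-free digraph \<open>G\<close>; the cost
  \<open>w u v\<close> may depend on the direction. \<open>vpath\<close> is a nonempty list of distinct nodes whose
  consecutive elements are linked.
\<close>

locale cache_network = pair_graph G
  for G :: "'v pair_pre_digraph" +
  fixes C :: "'i set"
    and S :: "'i \<Rightarrow> 'v set"
    and R :: "('i \<times> 'v list) set"
    and lam :: "'i \<times> 'v list \<Rightarrow> real"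
    and w :: "'v \<Rightarrow> 'v \<Rightarrow> real"
    and cbar :: "'v \<Rightarrow> nat"
    and M :: real
    and c0 :: "'v \<Rightarrow> real"
  assumes network_connected: "Digraph_Component.connected (with_proj G)"
    and finite_catalog: "finite C"
    and servers: "\<And>i. i \<in> C \<Longrightarrow> S i \<subseteq> pverts G"
    and finite_requests: "finite R"
    and requests: "\<And>i p. (i, p) \<in> R \<Longrightarrow> i \<in> C \<and> vpath p (with_proj G) \<and> last p \<in> S i"
    and rate_pos: "\<And>r. r \<in> R \<Longrightarrow> lam r > 0"
    and cost_nonneg: "\<And>u v. (u, v) \<in> parcs G \<Longrightarrow> w u v \<ge> 0"
    and budget_pos: "M > 0"
    and budget_less: "M < (\<Sum>v\<in>pverts G. real (cbar v))"
    and c0_sum: "(\<Sum>v\<in>pverts G. c0 v) = M"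

text \<open>Lists are indexed from 0, so the node \<open>p\<^sub>k\<close> of a path is \<open>p ! (k - 1)\<close>.\<close>

definition caching_gain ::
  "('i \<times> 'v list) set \<Rightarrow> ('i \<times> 'v list \<Rightarrow> real) \<Rightarrow> ('v \<Rightarrow> 'v \<Rightarrow> real) \<Rightarrow> ('v \<Rightarrow> 'i \<Rightarrow> real) \<Rightarrow> real"
  where "caching_gain R lam w X =
    (\<Sum>(i, p)\<in>R. lam (i, p) *
      (\<Sum>k = 1..length p - 1. w (p ! k) (p ! (k - 1)) *
        (1 - (\<Prod>l = 1..k. 1 - X (p ! (l - 1)) i))))"

definition maxcg_feasible ::
  "'v set \<Rightarrow> 'i set \<Rightarrow> ('i \<Rightarrow> 'v set) \<Rightarrow> ('v \<Rightarrow> nat) \<Rightarrow> real \<Rightarrow> ('v \<Rightarrow> 'i \<Rightarrow> real) \<Rightarrow> bool"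
  where "maxcg_feasible V C S cbar M X \<longleftrightarrow>
    (\<forall>v\<in>V. \<forall>i\<in>C. X v i \<in> {0, 1}) \<and>
    (\<forall>i\<in>C. \<forall>v\<in>S i. X v i = 1) \<and>
    (\<forall>v\<in>V. (\<Sum>i\<in>C. X v i) \<le> real (cbar v)) \<and>
    (\<Sum>v\<in>V. \<Sum>i\<in>C. X v i) \<le> M"

definition node_feasible ::
  "'i set \<Rightarrow> ('i \<Rightarrow> 'v set) \<Rightarrow> ('v \<Rightarrow> nat) \<Rightarrow> 'v \<Rightarrow> ('i \<Rightarrow> real) set"
  where "node_feasible C S cbar v =
    {y. (\<forall>i\<in>C. 0 \<le> y i \<and> y i \<le> 1) \<and>
        (\<Sum>i\<in>C. y i) \<le> real (cbar v) \<and>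
        (\<forall>i\<in>C. v \<in> S i \<longrightarrow> y i = 1)}"

text \<open>The last branch is only meant for \<open>x \<ge> 0\<close>; negative arguments do not occur in use.\<close>

definition sat :: "real \<Rightarrow> real \<Rightarrow> real"
  where "sat \<alpha> x =
    (if x \<ge> 1 + \<alpha> / 2 then 1
     else if x \<ge> 1 - \<alpha> / 2 then 1 - (1 + \<alpha> / 2 - x)\<^sup>2 / (2 * \<alpha>)
     else x)"

definition smoothed_gain ::
  "('i \<times> 'v list) set \<Rightarrow> ('i \<times> 'v list \<Rightarrow> real) \<Rightarrow> ('v \<Rightarrow> 'v \<Rightarrow> real) \<Rightarrow> real \<Rightarrow>
    ('v \<Rightarrow> 'i \<Rightarrow> real) \<Rightarrow> real"
  where "smoothed_gain R lam w \<alpha> Y =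
    (\<Sum>(i, p)\<in>R. lam (i, p) *
      (\<Sum>k = 1..length p - 1. w (p ! k) (p ! (k - 1)) *
        sat \<alpha> (\<Sum>l = 1..k. Y (p ! (l - 1)) i)))"

definition penalized_objective ::
  "'v set \<Rightarrow> 'i set \<Rightarrow> ('i \<times> 'v list) set \<Rightarrow> ('i \<times> 'v list \<Rightarrow> real) \<Rightarrow> ('v \<Rightarrow> 'v \<Rightarrow> real) \<Rightarrow>
    ('v \<Rightarrow> real) \<Rightarrow> real \<Rightarrow> real \<Rightarrow> ('v \<Rightarrow> 'i \<Rightarrow> real) \<Rightarrow> real"
  where "penalized_objective V C R lam w c0 \<mu> \<alpha> Y =
    smoothed_gain R lam w \<alpha> Y -
    \<mu> / (2 * real (card V)) * (max (\<Sum>v\<in>V. (\<Sum>i\<in>C. Y v i) - c0 v) 0)\<^sup>2"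

definition maxcg_optimal ::
  "'v set \<Rightarrow> 'i set \<Rightarrow> ('i \<Rightarrow> 'v set) \<Rightarrow> ('i \<times> 'v list) set \<Rightarrow> ('i \<times> 'v list \<Rightarrow> real) \<Rightarrow>
    ('v \<Rightarrow> 'v \<Rightarrow> real) \<Rightarrow> ('v \<Rightarrow> nat) \<Rightarrow> real \<Rightarrow> ('v \<Rightarrow> 'i \<Rightarrow> real) \<Rightarrow> bool"
  where "maxcg_optimal V C S R lam w cbar M =
    is_arg_max (caching_gain R lam w) (maxcg_feasible V C S cbar M)"

definition penalized_optimal ::
  "'v set \<Rightarrow> 'i set \<Rightarrow> ('i \<Rightarrow> 'v set) \<Rightarrow> ('i \<times> 'v list) set \<Rightarrow> ('i \<times> 'v list \<Rightarrow> real) \<Rightarrow>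
    ('v \<Rightarrow> 'v \<Rightarrow> real) \<Rightarrow> ('v \<Rightarrow> nat) \<Rightarrow> ('v \<Rightarrow> real) \<Rightarrow> real \<Rightarrow> real \<Rightarrow>
    ('v \<Rightarrow> 'i \<Rightarrow> real) \<Rightarrow> bool"
  where "penalized_optimal V C S R lam w cbar c0 \<mu> \<alpha> =
    is_arg_max (penalized_objective V C R lam w c0 \<mu> \<alpha>)
      (\<lambda>Y. \<forall>v\<in>V. Y v \<in> node_feasible C S cbar v)"

end

theory Submission
  imports Defs "HOL-Analysis.Convex"
begin

text \<open>
  Put \<open>s = \<Sum>\<^sub>l y\<^sub>l\<close>. Term by term, \<open>1 - \<Prod>\<^sub>l (1 - y\<^sub>l) \<ge> (1 - 1/e) min 1 s \<ge> (1 - 1/e) sat\<^sub>\<alpha> s\<close> for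
  fractional \<open>y\<close>, whereas \<open>sat\<^sub>\<alpha> s \<ge> (1 - \<alpha>/8) (1 - \<Prod>\<^sub>l (1 - y\<^sub>l))\<close> for binary \<open>y\<close>, because the
  smoothing costs at most \<open>\<alpha>/8\<close>, the loss at \<open>s = 1\<close>. Since \<open>X\<^sup>*\<close> is a penalty-free competitor in the
  penalized problem, its optimal solutions satisfy \<open>F Y \<ge> (1 - 1/e) (1 - \<alpha>/8) F X\<^sup>*\<close> for every
  \<open>\<mu> \<ge> 0\<close>.
\<close>

lemma sat_le_min:
  assumes "0 < \<alpha>"
  shows "sat \<alpha> x \<le> min 1 x"
proof (cases "1 - \<alpha> / 2 \<le> x \<and> x < 1 + \<alpha> / 2")
  case True
  \<comment> \<open>The quadratic branch is tangent to the line \<open>x\<close> at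
    \<open>1 - \<alpha> / 2\<close> and to the constant 1 at \<open>1 + \<alpha> / 2\<close>, so its
    gap to each of them is a square over \<open>2 * \<alpha>\<close>.\<close>
  have "x - (1 - (1 + \<alpha> / 2 - x)\<^sup>2 / (2 * \<alpha>)) = (1 - \<alpha> / 2 - x)\<^sup>2 / (2 * \<alpha>)"
    using assms by (simp add: field_simps power2_eq_square)
  moreover have "0 \<le> (1 - \<alpha> / 2 - x)\<^sup>2 / (2 * \<alpha>)" "0 \<le> (1 + \<alpha> / 2 - x)\<^sup>2 / (2 * \<alpha>)"
    using assms by simp_all
  ultimately have "1 - (1 + \<alpha> / 2 - x)\<^sup>2 / (2 * \<alpha>) \<le> min 1 x"
    by linarith
  then show ?thesis
    using True by (simp add: sat_def)
next
  case False
  then show ?thesis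
    using assms by (auto simp: sat_def)
qed

lemma sat_ge:
  assumes "0 < \<alpha>" "1 \<le> x"
  shows "1 - \<alpha> / 8 \<le> sat \<alpha> x"
proof (cases "x < 1 + \<alpha> / 2")
  case True
  have "(1 + \<alpha> / 2 - x)\<^sup>2 \<le> (\<alpha> / 2)\<^sup>2"
    using assms True by (intro power_mono) auto
  then have "(1 + \<alpha> / 2 - x)\<^sup>2 / (2 * \<alpha>) \<le> \<alpha> / 8"
    using assms by (simp add: field_simps power2_eq_square)
  then show ?thesis
    using assms True by (simp add: sat_def)
next
  case False
  then show ?thesis
    using assms by (simp add: sat_def)
qed

text \<open>The function \<open>1 - exp (- s)\<close> is concave, so on [0, 1] it lies above its
  chord from (0, 0) to (1, 1 - 1/e); for larger \<open>s\<close> monotonicity suffices.\<close>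

lemma one_minus_exp_minus_ge:
  fixes s :: real
  assumes "0 \<le> s"
  shows "(1 - 1 / exp 1) * min 1 s \<le> 1 - exp (- s)"
proof (cases "s \<le> 1")
  case True
  have "exp ((1 - s) *\<^sub>R 0 + s *\<^sub>R (- 1)) \<le> (1 - s) * exp 0 + s * exp (- 1 :: real)"
    using assms True by (intro convex_onD[OF exp_convex]) auto
  then show ?thesis
    using True by (simp add: exp_minus field_simps)
next
  case False
  then have "exp (- s) \<le> exp (- 1)"
    by simp
  then show ?thesis
    using False by (simp add: exp_minus field_simps)
qed

lemma prod_one_minus_le_exp:
  fixes y :: "'a \<Rightarrow> real"
  assumes "finite A" "\<And>l. l \<in> A \<Longrightarrow> y l \<le> 1"
  shows "(\<Prod>l\<in>A. 1 - y l) \<le> exp (- (\<Sum>l\<in>A. y l))"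
proof -
  have "(\<Prod>l\<in>A. 1 - y l) \<le> (\<Prod>l\<in>A. exp (- y l))"
    \<comment> \<open>The bound \<open>y l \<le> 1\<close> keeps the factors on the left
      nonnegative, as a factorwise comparison of products requires.\<close>
    using assms(2) exp_ge_add_one_self[of "- y l" for l] by (intro prod_mono) auto
  also have "\<dots> = exp (- (\<Sum>l\<in>A. y l))"
    using assms(1) by (simp add: exp_sum flip: sum_negf)
  finally show ?thesis .
qed

lemma one_minus_prod_ge_sat:
  fixes y :: "'a \<Rightarrow> real"
  assumes "0 < \<alpha>" "finite A" "\<And>l. l \<in> A \<Longrightarrow> 0 \<le> y l \<and> y l \<le> 1"
  shows "(1 - 1 / exp 1) * sat \<alpha> (\<Sum>l\<in>A. y l) \<le> 1 - (\<Prod>l\<in>A. 1 - y l)"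
proof -
  let ?s = "\<Sum>l\<in>A. y l"
  have "(1 - 1 / exp 1) * sat \<alpha> ?s \<le> (1 - 1 / exp 1) * min 1 ?s"
    using sat_le_min[OF assms(1)] by (intro mult_left_mono) auto
  also have "\<dots> \<le> 1 - exp (- ?s)"
    using assms(3) by (intro one_minus_exp_minus_ge sum_nonneg) auto
  also have "\<dots> \<le> 1 - (\<Prod>l\<in>A. 1 - y l)"
    using prod_one_minus_le_exp[of A y] assms(2,3) by auto
  finally show ?thesis .
qed

text \<open>For binary values the bracket \<open>1 - (\<Prod>l\<in>A. 1 - x l)\<close> is 0 or 1,
  and it is 1 exactly when some \<open>x l\<close> is 1; then the sum is at least 1 and only the
  smoothing loss remains.\<close>

lemma sat_ge_one_minus_prod_binary:
  fixes x :: "'a \<Rightarrow> real"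
  assumes "0 < \<alpha>" "\<alpha> < 1" "finite A" "\<And>l. l \<in> A \<Longrightarrow> x l \<in> {0, 1}"
  shows "(1 - \<alpha> / 8) * (1 - (\<Prod>l\<in>A. 1 - x l)) \<le> sat \<alpha> (\<Sum>l\<in>A. x l)"
proof (cases "\<forall>l\<in>A. x l = 0")
  case True
  \<comment> \<open>As \<open>\<alpha> < 1\<close>, the argument 0 falls in the linear branch, so
    both sides are 0.\<close>
  then show ?thesis
    using assms by (simp add: sat_def)
next
  case False
  then obtain m where m: "m \<in> A" "x m = 1"
    using assms(4) by blast
  have "(\<Prod>l\<in>A. 1 - x l) = 0"
    using m assms(3) by force
  moreover have "x m \<le> (\<Sum>l\<in>A. x l)"
    using m(1) assms(3,4) by (intro member_le_sum) force+
  ultimately show ?thesis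
    using m sat_ge[OF assms(1)] by simp
qed

lemma vwalk_arcs_nth:
  assumes "Suc n < length p"
  shows "(p ! n, p ! Suc n) \<in> set (vwalk_arcs p)"
  using assms
proof (induction p arbitrary: n rule: vwalk_arcs.induct)
  case (3 x y xs)
  then show ?case
    by (cases n) auto
qed auto

context cache_network
begin

lemma request_item: "(i, p) \<in> R \<Longrightarrow> i \<in> C"
  using requests by blast

lemma request_node:
  assumes "(i, p) \<in> R" "n < length p"
  shows "p ! n \<in> pverts G"
  using requests[OF assms(1)] assms(2) by (auto simp: vpath_def vwalk_def)

lemma request_cost_nonneg:
  assumes "(i, p) \<in> R" "k \<in> {1..length p - 1}"
  shows "0 \<le> w (p ! k) (p ! (k - 1))"
proof -
  have "(p ! (k - 1), p ! k) \<in> set (vwalk_arcs p)"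
    using vwalk_arcs_nth[of "k - 1" p] assms(2) by auto
  then have "(p ! (k - 1), p ! k) \<in> parcs G"
    using requests[OF assms(1)] by (auto simp: vpath_def vwalk_def)
  \<comment> \<open>The cost is charged on the arc opposite to the direction of the path, hence the
    appeal to symmetry of the network.\<close>
  then show ?thesis
    using arcs_symmetric cost_nonneg by blast
qed

text \<open>Both gains are sums of this shape with nonnegative weights, so a comparison of single
  terms up to a factor \<open>a\<close> carries over to them. It is applied with \<open>a\<close>
  equal to 1 - 1/e, to \<open>1 - \<alpha> / 8\<close> and to 0.\<close>

lemma gain_sum_mono:
  assumes "\<And>i p k. (i, p) \<in> R \<Longrightarrow> k \<in> {1..length p - 1} \<Longrightarrow> a * f i p k \<le> g i p k"
  shows "a * (\<Sum>(i, p)\<in>R. lam (i, p) * (\<Sum>k = 1..length p - 1. w (p ! k) (p ! (k - 1)) * f i p k))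
    \<le> (\<Sum>(i, p)\<in>R. lam (i, p) * (\<Sum>k = 1..length p - 1. w (p ! k) (p ! (k - 1)) * g i p k))"
proof -
  have "a * (lam (i, p) * (\<Sum>k = 1..length p - 1. w (p ! k) (p ! (k - 1)) * f i p k))
      \<le> lam (i, p) * (\<Sum>k = 1..length p - 1. w (p ! k) (p ! (k - 1)) * g i p k)"
    if ip: "(i, p) \<in> R" for i p
  proof -
    have "(\<Sum>k = 1..length p - 1. w (p ! k) (p ! (k - 1)) * (a * f i p k))
        \<le> (\<Sum>k = 1..length p - 1. w (p ! k) (p ! (k - 1)) * g i p k)"
      by (intro sum_mono mult_left_mono assms[OF ip] request_cost_nonneg[OF ip])
    then have "lam (i, p) * (\<Sum>k = 1..length p - 1. w (p ! k) (p ! (k - 1)) * (a * f i p k))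
        \<le> lam (i, p) * (\<Sum>k = 1..length p - 1. w (p ! k) (p ! (k - 1)) * g i p k)"
      using rate_pos[OF ip] by (intro mult_left_mono) auto
    then show ?thesis
      by (simp add: sum_distrib_left mult.left_commute)
  qed
  then show ?thesis
    unfolding sum_distrib_left[of a _ R] by (intro sum_mono) auto
qed

lemma smoothed_gain_le_caching_gain:
  assumes "0 < \<alpha>" "\<And>v i. v \<in> pverts G \<Longrightarrow> i \<in> C \<Longrightarrow> 0 \<le> Y v i \<and> Y v i \<le> 1"
  shows "(1 - 1 / exp 1) * smoothed_gain R lam w \<alpha> Y \<le> caching_gain R lam w Y"
  unfolding smoothed_gain_def caching_gain_def
proof (intro gain_sum_mono one_minus_prod_ge_sat)
  fix i p k l
  assume "(i, p) \<in> R" "k \<in> {1..length p - 1}" "l \<in> {1..k}"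
  then show "0 \<le> Y (p ! (l - 1)) i \<and> Y (p ! (l - 1)) i \<le> 1"
    by (intro assms(2) request_item request_node) auto
qed (use assms in auto)

lemma caching_gain_le_smoothed_gain_binary:
  assumes "0 < \<alpha>" "\<alpha> < 1" "\<And>v i. v \<in> pverts G \<Longrightarrow> i \<in> C \<Longrightarrow> X v i \<in> {0, 1}"
  shows "(1 - \<alpha> / 8) * caching_gain R lam w X \<le> smoothed_gain R lam w \<alpha> X"
  unfolding smoothed_gain_def caching_gain_def
proof (intro gain_sum_mono sat_ge_one_minus_prod_binary)
  fix i p k l
  assume "(i, p) \<in> R" "k \<in> {1..length p - 1}" "l \<in> {1..k}"
  then show "X (p ! (l - 1)) i \<in> {0, 1}"
    by (intro assms(3) request_item request_node) auto
qed (use assms in auto)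

lemma caching_gain_nonneg:
  assumes "\<And>v i. v \<in> pverts G \<Longrightarrow> i \<in> C \<Longrightarrow> 0 \<le> X v i \<and> X v i \<le> 1"
  shows "0 \<le> caching_gain R lam w X"
proof -
  \<comment> \<open>The product \<open>0 * 0\<close> matches the premise of
    \<open>gain_sum_mono\<close> for \<open>a = 0\<close> and \<open>f\<close> constantly 0.\<close>
  have "0 * 0 \<le> 1 - (\<Prod>l = 1..k. 1 - X (p ! (l - 1)) i)"
    if "(i, p) \<in> R" "k \<in> {1..length p - 1}" for i p k
  proof -
    have "0 \<le> X (p ! (l - 1)) i \<and> X (p ! (l - 1)) i \<le> 1" if "l \<in> {1..k}" for l
      using that \<open>(i, p) \<in> R\<close> \<open>k \<in> _\<close> by (intro assms request_item request_node) auto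
    then show ?thesis
      by (auto intro: prod_le_1)
  qed
  from gain_sum_mono[of 0 "\<lambda>_ _ _. 0", OF this] show ?thesis
    by (simp add: caching_gain_def)
qed

lemma maxcg_feasible_node_feasible:
  assumes "maxcg_feasible (pverts G) C S cbar M X" "v \<in> pverts G"
  shows "X v \<in> node_feasible C S cbar v"
  using assms unfolding maxcg_feasible_def node_feasible_def by fastforce

lemma penalized_optimal_approximation:
  fixes \<mu> \<alpha> :: real
  assumes X: "maxcg_feasible (pverts G) C S cbar M X"
    and Y: "penalized_optimal (pverts G) C S R lam w cbar c0 \<mu> \<alpha> Y"
    and "0 \<le> \<mu>" "0 < \<alpha>" "\<alpha> < 1"
  shows "(1 - 1 / exp 1) * (1 - \<alpha> / 8) * caching_gain R lam w X \<le> caching_gain R lam w Y"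
proof -
  \<comment> \<open>Since \<open>c0\<close> sums to \<open>M\<close>, this is the budget constraint,
    and the penalty of \<open>X\<close> vanishes.\<close>
  have "(\<Sum>v\<in>pverts G. (\<Sum>i\<in>C. X v i) - c0 v) \<le> 0"
    using X c0_sum by (simp add: sum_subtractf maxcg_feasible_def)
  then have "smoothed_gain R lam w \<alpha> X = penalized_objective (pverts G) C R lam w c0 \<mu> \<alpha> X"
    by (simp add: penalized_objective_def)
  also have "\<dots> \<le> penalized_objective (pverts G) C R lam w c0 \<mu> \<alpha> Y"
    using Y maxcg_feasible_node_feasible[OF X]
    by (auto simp: penalized_optimal_def is_arg_max_def not_less)
  \<comment> \<open>\<open>Y\<close> may exceed the budget; its penalty is simply dropped, being
    nonnegative.\<close>
  also have "\<dots> \<le> smoothed_gain R lam w \<alpha> Y"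
    using \<open>0 \<le> \<mu>\<close> by (simp add: penalized_objective_def)
  finally have "(1 - \<alpha> / 8) * caching_gain R lam w X \<le> smoothed_gain R lam w \<alpha> Y"
    using caching_gain_le_smoothed_gain_binary[of \<alpha> X] X assms(4,5)
    by (auto simp: maxcg_feasible_def)
  then have "(1 - 1 / exp 1) * ((1 - \<alpha> / 8) * caching_gain R lam w X)
      \<le> (1 - 1 / exp 1) * smoothed_gain R lam w \<alpha> Y"
    by (intro mult_left_mono) auto
  also have "\<dots> \<le> caching_gain R lam w Y"
    using Y \<open>0 < \<alpha>\<close> by (intro smoothed_gain_le_caching_gain)
      (auto simp: penalized_optimal_def is_arg_max_def node_feasible_def)
  finally show ?thesis
    by (simp add: mult.assoc)
qed

end

theorem theorem2:
  fixes G :: "'v pair_pre_digraph"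
    and C :: "'i set"
    and S :: "'i \<Rightarrow> 'v set"
    and R :: "('i \<times> 'v list) set"
    and lam :: "'i \<times> 'v list \<Rightarrow> real"
    and w :: "'v \<Rightarrow> 'v \<Rightarrow> real"
    and cbar :: "'v \<Rightarrow> nat"
    and M :: real
    and c0 :: "'v \<Rightarrow> real"
    and Xopt :: "'v \<Rightarrow> 'i \<Rightarrow> real"
    and \<epsilon> :: real
  assumes "cache_network G C S R lam w cbar M c0"
    and "maxcg_optimal (pverts G) C S R lam w cbar M Xopt"
    and "\<epsilon> > 0"
  shows "\<exists>\<mu>0>0. \<exists>\<alpha>0. 0 < \<alpha>0 \<and> \<alpha>0 < 1 \<and>
    (\<forall>\<mu>\<ge>\<mu>0. \<forall>\<alpha>. 0 < \<alpha> \<and> \<alpha> \<le> \<alpha>0 \<longrightarrow>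
      (\<forall>Y. penalized_optimal (pverts G) C S R lam w cbar c0 \<mu> \<alpha> Y \<longrightarrow>
        caching_gain R lam w Y \<ge> (1 - 1 / exp 1 - \<epsilon>) * caching_gain R lam w Xopt))"
proof -
  interpret cache_network G C S R lam w cbar M c0
    by fact
  let ?F = "caching_gain R lam w"
  have X: "maxcg_feasible (pverts G) C S cbar M Xopt"
    using assms(2) by (simp add: maxcg_optimal_def is_arg_max_def)
  \<comment> \<open>Needed to turn an inequality between ratios into one between multiples of
    \<open>?F Xopt\<close>.\<close>
  have "0 \<le> ?F Xopt"
    using maxcg_feasible_node_feasible[OF X] by (intro caching_gain_nonneg) (auto simp: node_feasible_def)
  have approx: "(1 - 1 / exp 1 - \<epsilon>) * ?F Xopt \<le> ?F Y"
    if "1 \<le> \<mu>" "0 < \<alpha>" "\<alpha> \<le> min (1 / 2) \<epsilon>"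
      "penalized_optimal (pverts G) C S R lam w cbar c0 \<mu> \<alpha> Y" for \<mu> \<alpha> :: real and Y
  proof -
    have "(1 - 1 / exp 1) * (\<alpha> / 8) \<le> 1 * \<epsilon>"
      using that by (intro mult_mono) auto
    then have "1 - 1 / exp 1 - \<epsilon> \<le> (1 - 1 / exp 1) * (1 - \<alpha> / 8)"
      by (simp add: algebra_simps)
    then have "(1 - 1 / exp 1 - \<epsilon>) * ?F Xopt \<le> (1 - 1 / exp 1) * (1 - \<alpha> / 8) * ?F Xopt"
      using \<open>0 \<le> ?F Xopt\<close> by (intro mult_right_mono)
    also have "\<dots> \<le> ?F Y"
      using that by (intro penalized_optimal_approximation[OF X]) auto
    finally show ?thesis .
  qed
  \<comment> \<open>Any positive \<mu>0 would do. In \<alpha>0 the 1/2 keeps the value below 1, and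
    \<epsilon> bounds the ratio lost to smoothing, which is at most
    \<open>\<alpha> / 8\<close>.\<close>
  show ?thesis
    using \<open>\<epsilon> > 0\<close> approx
    by (intro exI[of _ 1] exI[of _ "min (1 / 2) \<epsilon>"] conjI allI impI) auto
qed

end
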